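(* Let $g:\mathbb{C}\times\mathbb{C}\to\mathbb{C}$ be antisymmetric, $g(x,y)=-g(y,x)$, and let $f:\mathbb{C}\times\mathbb{C}\to\mathbb{C}$ belong to $\mathrm{Ker}\,\mathcal{L}^{(g)}_3$. Let $F,H$ be functions of one complex variable, let $n\geq 0$ be an integer, and let $\{x_i\}$, $\{b_i\}$ be sequences of complex numbers (the nodes $b_i$ pairwise distinct) such that no denominator occurring below vanishes. Then $$\mathbb{D}^{(n)}_{(f,g)}\left[\begin{matrix}b_0,b_1,\dots,b_n\\ x_1,\dots,x_{n-1}\end{matrix}\right]\{F(x)H(x)\}=\sum_{k=0}^n f(x_k,b_k)\,\mathbb{D}^{(k)}_{(f,g)}\left[\begin{matrix}b_0,b_1,\dots,b_k\\ x_1,\dots,x_{k-1}\end{matrix}\right]\{H(x)\}\;\mathbb{D}^{(n-k)}_{(f,g)}\left[\begin{matrix}b_k,b_{k+1},\dots,b_n\\ x_{k+1},\dots,x_{n-1}\end{matrix}\right]\{F(x)\}.$$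
   Context: For antisymmetric $g$, $\mathrm{Ker}\,\mathcal{L}^{(g)}_3$ is the set of functions $f(x,y)$ of two complex variables such that for all $a,b,c,x\in\mathbb{C}$: $f(x,a)g(b,c)+f(x,b)g(c,a)+f(x,c)g(a,b)=0$. The $(f,g)$-difference operator of order $m\ge 0$ with nodes $b_r,\dots,b_{r+m}$ and parameters $x_{s+1},\dots,x_{s+m-1}$ is $$\mathbb{D}^{(m)}_{(f,g)}\left[\begin{matrix}b_r,b_{r+1},\dots,b_{r+m}\\ x_{s+1},\dots,x_{s+m-1}\end{matrix}\right]\{F(x)\}=\sum_{k=r}^{r+m}F(b_k)\frac{\prod_{i=s+1}^{s+m-1}f(x_i,b_k)}{\prod_{i=r,\,i\ne k}^{r+m}g(b_i,b_k)}.$$ For $m=1$ the numerator product is empty (equal to $1$). For $m=0$, by the convention $\prod_{i=s+1}^{s-1}A_i=1/A_s$, the value is $F(b_r)/f(x_s,b_r)$. Thus in the formula the $k=0$ term involves $\mathbb{D}^{(0)}\{H\}=H(b_0)/f(x_0,b_0)$ and the $k=n$ term involves $\mathbb{D}^{(0)}\{F\}=F(b_n)/f(x_n,b_n)$. *)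

theory Defs
  imports Complex_Main
begin

definition antisymmetric :: "(complex \<Rightarrow> complex \<Rightarrow> complex) \<Rightarrow> bool" where
  "antisymmetric g \<longleftrightarrow> (\<forall>x y. g x y = - g y x)"

definition KerL3 :: "(complex \<Rightarrow> complex \<Rightarrow> complex) \<Rightarrow> (complex \<Rightarrow> complex \<Rightarrow> complex) set" where
  "KerL3 g = {f. \<forall>a b c x. f x a * g b c + f x b * g c a + f x c * g a b = 0}"

text \<open>
  The product of \<open>A i\<close> for \<open>i\<close> from \<open>s + 1\<close> to \<open>s + m - 1\<close>.  For \<open>m = 1\<close> it is empty; for
  \<open>m = 0\<close> the upper limit lies two below the lower one, and the product is by convention
  \<open>1 / A s\<close> (and not \<open>1\<close>).
\<close>
definition param_prod :: "(nat \<Rightarrow> complex) \<Rightarrow> nat \<Rightarrow> nat \<Rightarrow> complex" where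
  "param_prod A s m = (if m = 0 then 1 / A s else (\<Prod>i = s + 1..s + m - 1. A i))"

text \<open>
  The \<open>(f, g)\<close>-difference operator of order \<open>m\<close> with nodes \<open>b r, \<dots>, b (r + m)\<close> and parameters
  \<open>x (s + 1), \<dots>, x (s + m - 1)\<close>, applied to \<open>F\<close>.  For \<open>m = 0\<close> its value is
  \<open>F (b r) / f (x s) (b r)\<close>, so that it then depends on \<open>x s\<close>.
\<close>
definition diff_op ::
  "(complex \<Rightarrow> complex \<Rightarrow> complex) \<Rightarrow> (complex \<Rightarrow> complex \<Rightarrow> complex) \<Rightarrow> nat \<Rightarrow>
   (nat \<Rightarrow> complex) \<Rightarrow> nat \<Rightarrow> (nat \<Rightarrow> complex) \<Rightarrow> nat \<Rightarrow> (complex \<Rightarrow> complex) \<Rightarrow> complex" where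
  "diff_op f g m b r x s F =
     (\<Sum>k = r..r + m. F (b k) * param_prod (\<lambda>i. f (x i) (b k)) s m
                       / (\<Prod>i \<in> {r..r + m} - {k}. g (b i) (b k)))"

end

theory Submission
  imports Defs
begin

text \<open>
  Both sides are bilinear in the values \<open>H (b i)\<close> and \<open>F (b j)\<close>, so it suffices to compare their
  coefficients.  On the right, \<open>H (b i)\<close> occurs in the \<open>k\<close>-th summand only for \<open>i \<le> k\<close> and
  \<open>F (b j)\<close> only for \<open>k \<le> j\<close>; the coefficient of \<open>H (b i) * F (b j)\<close> is therefore a sum over
  \<open>k = i..j\<close>.

  For \<open>i > j\<close> this sum is empty.  For \<open>i = j\<close> only \<open>k = i\<close> contributes: the nodes
  \<open>b 0, \<dots>, b i\<close> and \<open>b i, \<dots>, b n\<close> of the two factors share just the node \<open>b i\<close>, while the factor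
  \<open>f (x i) (b i)\<close> is exactly the one missing between the parameters \<open>x 1, \<dots>, x (i - 1)\<close> and
  \<open>x (i + 1), \<dots>, x (n - 1)\<close>, so that the coefficient on the left results
  (\<open>bilinear_coeff_diagonal\<close>); at \<open>i = 0\<close> and \<open>i = n\<close> no parameter is missing, and that factor
  cancels against the inverse supplied by the order \<open>0\<close> operator.

  For \<open>i < j\<close> the sum vanishes because it telescopes.  The kernel condition at the points
  \<open>b k\<close>, \<open>b i\<close>, \<open>b j\<close> reads
  \<open>f (x k) (b k) * g (b i) (b j) = f (x k) (b i) * g (b k) (b j) - f (x k) (b j) * g (b k) (b i)\<close>.
  In the first term on the right, \<open>f (x k) (b i)\<close> extends the numerator product at \<open>b i\<close> and
  \<open>g (b k) (b j)\<close> cancels a factor of the denominator at \<open>b j\<close>; the second term does the same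
  with \<open>i\<close> and \<open>j\<close> exchanged.  Thus, up to the constant \<open>g (b i) (b j)\<close>, the summand is a
  difference of consecutive values of one sequence (\<open>bilinear_coeff_difference\<close>) that is zero
  at both ends.
\<close>

section \<open>Products over parameters and over nodes\<close>

text \<open>
  The value at \<open>m = 0\<close> is the one that extends the recursions on either side down to \<open>m = 0\<close>,
  provided that the inverted factor does not vanish.
\<close>

lemma param_prod_extend_right:
  assumes "m > 0 \<or> A s \<noteq> 0"
  shows "A (s + m) * param_prod A s m = param_prod A s (Suc m)"
proof (cases m)
  case 0
  then show ?thesis using assms by (simp add: param_prod_def)
next
  case (Suc l)
  then show ?thesis by (simp add: param_prod_def mult.commute)
qed

lemma param_prod_extend_left:
  assumes "m > 0 \<or> A (Suc s) \<noteq> 0"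
  shows "A (Suc s) * param_prod A (Suc s) m = param_prod A s (Suc m)"
proof (cases m)
  case 0
  then show ?thesis using assms by (simp add: param_prod_def)
next
  case (Suc l)
  have "(\<Prod>i = Suc s..Suc (s + l). A i) = A (Suc s) * (\<Prod>i = Suc (Suc s)..Suc (s + l). A i)"
    by (rule prod.atLeast_Suc_atMost) simp
  then show ?thesis using Suc by (simp add: param_prod_def)
qed

lemma param_prod_join:
  assumes "k \<le> n" "k > 0 \<or> A 0 \<noteq> 0" "k < n \<or> A n \<noteq> 0"
  shows "A k * param_prod A 0 k * param_prod A k (n - k) = param_prod A 0 n"
proof (cases k)
  case 0
  then show ?thesis using assms by (simp add: param_prod_def)
next
  case (Suc l)
  have "param_prod A 0 k * param_prod A l (n - l) = param_prod A 0 n"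
  proof -
    have "{1..n - 1} = {1..l} \<union> {Suc l..n - 1}" "{1..l} \<inter> {Suc l..n - 1} = {}"
      using assms(1) Suc by auto
    then have "(\<Prod>i = 1..n - 1. A i) = (\<Prod>i = 1..l. A i) * (\<Prod>i = Suc l..n - 1. A i)"
      by (simp add: prod.union_disjoint)
    then show ?thesis
      using assms(1) Suc by (simp add: param_prod_def)
  qed
  moreover have "A k * param_prod A k (n - k) = param_prod A l (n - l)"
  proof -
    have "n - k > 0 \<or> A (Suc l) \<noteq> 0" using assms(1,3) Suc by auto
    moreover have "Suc (n - k) = n - l" using assms(1) Suc by simp
    ultimately show ?thesis using param_prod_extend_left[of "n - k" A l] Suc by simp
  qed
  moreover have "A k * param_prod A 0 k * param_prod A k (n - k)
      = param_prod A 0 k * (A k * param_prod A k (n - k))"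
    by (simp only: mult_ac)
  ultimately show ?thesis by simp
qed

definition node_prod ::
  "(complex \<Rightarrow> complex \<Rightarrow> complex) \<Rightarrow> (nat \<Rightarrow> complex) \<Rightarrow> nat set \<Rightarrow> nat \<Rightarrow> complex" where
  "node_prod g b S i = (\<Prod>t \<in> S - {i}. g (b t) (b i))"

lemma node_prod_insert:
  assumes "finite S" "k \<notin> S" "k \<noteq> i"
  shows "node_prod g b (insert k S) i = g (b k) (b i) * node_prod g b S i"
  using assms by (simp add: node_prod_def insert_Diff_if)

lemma node_prod_join:
  assumes "i \<le> n"
  shows "node_prod g b {0..i} i * node_prod g b {i..n} i = node_prod g b {0..n} i"
proof -
  have "{0..n} - {i} = ({0..i} - {i}) \<union> ({i..n} - {i})" using assms by auto
  moreover have "({0..i} - {i}) \<inter> ({i..n} - {i}) = {}" by auto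
  ultimately show ?thesis
    unfolding node_prod_def by (simp add: prod.union_disjoint)
qed

lemma diff_op_node_prod:
  "diff_op f g m b r x s F =
     (\<Sum>k = r..r + m. F (b k) * (param_prod (\<lambda>i. f (x i) (b k)) s m / node_prod g b {r..r + m} k))"
  by (simp add: diff_op_def node_prod_def)


section \<open>The coefficients of the right-hand side\<close>

text \<open>
  The coefficient of \<open>H (b i) * F (b j)\<close> in the \<open>k\<close>-th summand, meaningful for \<open>i \<le> k \<le> j\<close>.
\<close>
definition bilinear_coeff ::
  "(complex \<Rightarrow> complex \<Rightarrow> complex) \<Rightarrow> (complex \<Rightarrow> complex \<Rightarrow> complex) \<Rightarrow> (nat \<Rightarrow> complex) \<Rightarrow>
   (nat \<Rightarrow> complex) \<Rightarrow> nat \<Rightarrow> nat \<Rightarrow> nat \<Rightarrow> nat \<Rightarrow> complex" where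
  "bilinear_coeff f g b x n i j k =
     f (x k) (b k) * (param_prod (\<lambda>t. f (x t) (b i)) 0 k / node_prod g b {0..k} i)
       * (param_prod (\<lambda>t. f (x t) (b j)) k (n - k) / node_prod g b {k..n} j)"

text \<open>
  Its primitive with respect to \<open>k\<close>: the parameters \<open>x 1, \<dots>, x (k - 1)\<close> and the nodes before
  \<open>b k\<close> go with \<open>b i\<close>, the parameters \<open>x k, \<dots>, x (n - 1)\<close> and the nodes from \<open>b k\<close> on with
  \<open>b j\<close>.  Cutting it off to \<open>0\<close> outside \<open>i < k \<le> j\<close> accounts for the boundary: at \<open>k = i\<close> and
  at \<open>k = j\<close> one of the two terms in the kernel condition contains \<open>g (b k) (b k) = 0\<close>.
\<close>
definition coeff_primitive ::
  "(complex \<Rightarrow> complex \<Rightarrow> complex) \<Rightarrow> (complex \<Rightarrow> complex \<Rightarrow> complex) \<Rightarrow> (nat \<Rightarrow> complex) \<Rightarrow>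
   (nat \<Rightarrow> complex) \<Rightarrow> nat \<Rightarrow> nat \<Rightarrow> nat \<Rightarrow> nat \<Rightarrow> complex" where
  "coeff_primitive f g b x n i j k =
     (if i < k \<and> k \<le> j
      then param_prod (\<lambda>t. f (x t) (b i)) 0 k / node_prod g b {0..<k} i
             * (param_prod (\<lambda>t. f (x t) (b j)) (k - 1) (n - (k - 1)) / node_prod g b {k..n} j)
      else 0)"

lemma bilinear_coeff_diagonal:
  assumes "i \<le> n" "f (x 0) (b 0) \<noteq> 0" "f (x n) (b n) \<noteq> 0"
  shows "bilinear_coeff f g b x n i i i =
     param_prod (\<lambda>t. f (x t) (b i)) 0 n / node_prod g b {0..n} i"
proof -
  have "f (x i) (b i) * param_prod (\<lambda>t. f (x t) (b i)) 0 i
          * param_prod (\<lambda>t. f (x t) (b i)) i (n - i) = param_prod (\<lambda>t. f (x t) (b i)) 0 n"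
    using assms by (intro param_prod_join) (auto simp: le_less)
  then show ?thesis
    using node_prod_join[OF assms(1), of g b]
    by (simp add: bilinear_coeff_def)
qed

lemma KerL3_antisymmetric_three_term:
  assumes "antisymmetric g" "f \<in> KerL3 g"
  shows "f y a * g b c = f y b * g a c - f y c * g a b"
proof -
  have "f y a * g b c + f y b * g c a + f y c * g a b = 0"
    using assms(2) by (simp add: KerL3_def)
  moreover have "g c a = - g a c"
    using assms(1) unfolding antisymmetric_def by blast
  ultimately show ?thesis by (simp add: algebra_simps)
qed

lemma bilinear_coeff_difference:
  assumes g: "antisymmetric g" and f: "f \<in> KerL3 g"
    and nz: "\<And>i j. i \<le> n \<Longrightarrow> j \<le> n \<Longrightarrow> i \<noteq> j \<Longrightarrow> g (b i) (b j) \<noteq> 0"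
    and f0: "f (x 0) (b 0) \<noteq> 0" and fn: "f (x n) (b n) \<noteq> 0"
    and ijk: "i \<le> k" "k \<le> j" "i < j" "j \<le> n"
  shows "g (b i) (b j) * bilinear_coeff f g b x n i j k =
     coeff_primitive f g b x n i j (Suc k) - coeff_primitive f g b x n i j k"
proof -
  define P where "P = param_prod (\<lambda>t. f (x t) (b i)) 0 k / node_prod g b {0..k} i"
  define Q where "Q = param_prod (\<lambda>t. f (x t) (b j)) k (n - k) / node_prod g b {k..n} j"
  have diag: "g (b k) (b k) = 0"
  proof -
    have "g (b k) (b k) = - g (b k) (b k)"
      using g unfolding antisymmetric_def by blast
    then show ?thesis by simp
  qed
  have upper: "f (x k) (b i) * P * (g (b k) (b j) * Q) = coeff_primitive f g b x n i j (Suc k)"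
  proof (cases "k = j")
    case True
    then show ?thesis using diag by (simp add: coeff_primitive_def)
  next
    case False
    \<comment> \<open>At \<open>k = 0\<close> the convention divides by \<open>f (x 0) (b i)\<close>; but then \<open>i = 0\<close>.\<close>
    have "k > 0 \<or> f (x 0) (b i) \<noteq> 0" using f0 ijk(1) by (cases k) auto
    then have "f (x k) (b i) * param_prod (\<lambda>t. f (x t) (b i)) 0 k
            = param_prod (\<lambda>t. f (x t) (b i)) 0 (Suc k)"
      using param_prod_extend_right[of k "\<lambda>t. f (x t) (b i)" 0] by simp
    then have 1: "f (x k) (b i) * P
        = param_prod (\<lambda>t. f (x t) (b i)) 0 (Suc k) / node_prod g b {0..<Suc k} i"
      by (simp add: P_def atLeastLessThanSuc_atLeastAtMost)
    have "node_prod g b {k..n} j = g (b k) (b j) * node_prod g b {Suc k..n} j"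
      using node_prod_insert[of "{Suc k..n}" k j g b] False ijk
      by (simp add: atLeastAtMost_insertL)
    then have 2: "g (b k) (b j) * Q
        = param_prod (\<lambda>t. f (x t) (b j)) k (n - k) / node_prod g b {Suc k..n} j"
      using nz[of k j] False ijk by (simp add: Q_def)
    show ?thesis unfolding 1 2 using False ijk by (simp add: coeff_primitive_def)
  qed
  have lower: "g (b k) (b i) * P * (f (x k) (b j) * Q) = coeff_primitive f g b x n i j k"
  proof (cases "k = i")
    case True
    then show ?thesis using diag by (simp add: coeff_primitive_def)
  next
    case False
    then obtain l where l: "k = Suc l" using ijk by (cases k) auto
    \<comment> \<open>At \<open>k = n\<close> the convention divides by \<open>f (x n) (b j)\<close>; but then \<open>j = n\<close>.\<close>
    have "k < n \<or> k = n \<and> j = n" using ijk by linarith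
    then have "n - k > 0 \<or> f (x (Suc l)) (b j) \<noteq> 0" using fn l by (elim disjE) simp_all
    moreover have "Suc (n - k) = n - (k - 1)" using ijk l by simp
    ultimately have "f (x k) (b j) * param_prod (\<lambda>t. f (x t) (b j)) k (n - k)
            = param_prod (\<lambda>t. f (x t) (b j)) (k - 1) (n - (k - 1))"
      using param_prod_extend_left[of "n - k" "\<lambda>t. f (x t) (b j)" l] l by simp
    then have 1: "f (x k) (b j) * Q
        = param_prod (\<lambda>t. f (x t) (b j)) (k - 1) (n - (k - 1)) / node_prod g b {k..n} j"
      by (simp add: Q_def)
    have "{0..k} = insert k {0..<k}" by auto
    then have "node_prod g b {0..k} i = g (b k) (b i) * node_prod g b {0..<k} i"
      using node_prod_insert[of "{0..<k}" k i g b] False by simp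
    then have 2: "g (b k) (b i) * P
        = param_prod (\<lambda>t. f (x t) (b i)) 0 k / node_prod g b {0..<k} i"
      using nz[of k i] False ijk by (simp add: P_def)
    show ?thesis unfolding 1 2 using False ijk by (simp add: coeff_primitive_def)
  qed
  have "g (b i) (b j) * bilinear_coeff f g b x n i j k
      = (f (x k) (b k) * g (b i) (b j)) * P * Q"
    by (simp add: bilinear_coeff_def P_def Q_def)
  also have "\<dots> = f (x k) (b i) * P * (g (b k) (b j) * Q) - g (b k) (b i) * P * (f (x k) (b j) * Q)"
    by (subst KerL3_antisymmetric_three_term[OF g f, of "x k" "b k" "b i" "b j"])
      (simp add: algebra_simps)
  finally show ?thesis unfolding upper lower .
qed

lemma sum_bilinear_coeff_eq_0:
  assumes "antisymmetric g" "f \<in> KerL3 g"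
    and nz: "\<And>i j. i \<le> n \<Longrightarrow> j \<le> n \<Longrightarrow> i \<noteq> j \<Longrightarrow> g (b i) (b j) \<noteq> 0"
    and "f (x 0) (b 0) \<noteq> 0" "f (x n) (b n) \<noteq> 0"
    and ij: "i < j" "j \<le> n"
  shows "(\<Sum>k = i..j. bilinear_coeff f g b x n i j k) = 0"
proof -
  let ?V = "coeff_primitive f g b x n i j"
  have "g (b i) (b j) * (\<Sum>k = i..j. bilinear_coeff f g b x n i j k)
      = (\<Sum>k = i..j. ?V (Suc k) - ?V k)"
    unfolding sum_distrib_left
    by (rule sum.cong[OF refl], rule bilinear_coeff_difference) (use assms in auto)
  also have "\<dots> = ?V (Suc j) - ?V i"
    using ij by (intro sum_Suc_diff) simp
  also have "\<dots> = 0" by (simp add: coeff_primitive_def)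
  finally show ?thesis using nz[of i j] ij by simp
qed

lemma sum_reorder_around_middle_index:
  fixes h :: "nat \<Rightarrow> nat \<Rightarrow> nat \<Rightarrow> 'a::comm_monoid_add"
  shows "(\<Sum>k = 0..n. \<Sum>i = 0..k. \<Sum>j = k..n. h i j k) = (\<Sum>i = 0..n. \<Sum>j = 0..n. \<Sum>k = i..j. h i j k)"
proof -
  have "(\<Sum>k = 0..n. \<Sum>i = 0..k. \<Sum>j = k..n. h i j k)
      = (\<Sum>k = 0..n. \<Sum>i | i \<in> {0..n} \<and> i \<le> k. \<Sum>j = k..n. h i j k)"
    by (intro sum.cong refl) auto
  also have "\<dots> = (\<Sum>i = 0..n. \<Sum>k | k \<in> {0..n} \<and> i \<le> k. \<Sum>j = k..n. h i j k)"
    by (rule sum.swap_restrict) auto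
  also have "\<dots> = (\<Sum>i = 0..n. \<Sum>k = i..n. \<Sum>j | j \<in> {0..n} \<and> k \<le> j. h i j k)"
    by (intro sum.cong refl) auto
  also have "\<dots> = (\<Sum>i = 0..n. \<Sum>j = 0..n. \<Sum>k | k \<in> {i..n} \<and> k \<le> j. h i j k)"
    by (intro sum.cong refl sum.swap_restrict) auto
  also have "\<dots> = (\<Sum>i = 0..n. \<Sum>j = 0..n. \<Sum>k = i..j. h i j k)"
    by (intro sum.cong refl) auto
  finally show ?thesis .
qed


section \<open>The Leibniz formula\<close>

theorem theorem2p2:
  fixes f g :: "complex \<Rightarrow> complex \<Rightarrow> complex"
    and F H :: "complex \<Rightarrow> complex"
    and x b :: "nat \<Rightarrow> complex"
    and n :: nat
  assumes "antisymmetric g"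
    and "f \<in> KerL3 g"
    and "inj_on b {0..n}"
    and "\<And>i j. i \<le> n \<Longrightarrow> j \<le> n \<Longrightarrow> i \<noteq> j \<Longrightarrow> g (b i) (b j) \<noteq> 0"
    and "f (x 0) (b 0) \<noteq> 0"
    and "f (x n) (b n) \<noteq> 0"
  shows "diff_op f g n b 0 x 0 (\<lambda>z. F z * H z) =
    (\<Sum>k = 0..n. f (x k) (b k) * diff_op f g k b 0 x 0 H * diff_op f g (n - k) b k x k F)"
proof -
  let ?c = "bilinear_coeff f g b x n"
  have coeff: "(\<Sum>k = i..j. ?c i j k) =
      (if i = j then param_prod (\<lambda>t. f (x t) (b i)) 0 n / node_prod g b {0..n} i else 0)"
    if "i \<le> n" "j \<le> n" for i j
  proof (cases i j rule: linorder_cases)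
    case less
    then show ?thesis using sum_bilinear_coeff_eq_0[OF assms(1,2,4-6) less that(2)] by simp
  next
    case equal
    then show ?thesis by (simp add: bilinear_coeff_diagonal that assms(5,6))
  next
    case greater
    then show ?thesis by simp
  qed
  have "f (x k) (b k) * diff_op f g k b 0 x 0 H * diff_op f g (n - k) b k x k F
      = (\<Sum>i = 0..k. \<Sum>j = k..n. H (b i) * F (b j) * ?c i j k)" if "k \<le> n" for k
    using that
    by (simp add: diff_op_node_prod bilinear_coeff_def sum_product sum_distrib_left mult_ac)
  then have "(\<Sum>k = 0..n. f (x k) (b k) * diff_op f g k b 0 x 0 H * diff_op f g (n - k) b k x k F)
      = (\<Sum>k = 0..n. \<Sum>i = 0..k. \<Sum>j = k..n. H (b i) * F (b j) * ?c i j k)"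
    by (intro sum.cong refl) simp
  also have "\<dots> = (\<Sum>i = 0..n. \<Sum>j = 0..n. H (b i) * F (b j) * (\<Sum>k = i..j. ?c i j k))"
    by (simp only: sum_reorder_around_middle_index sum_distrib_left)
  also have "\<dots> = (\<Sum>i = 0..n. \<Sum>j = 0..n. if i = j then H (b i) * F (b i) *
      (param_prod (\<lambda>t. f (x t) (b i)) 0 n / node_prod g b {0..n} i) else 0)"
    by (intro sum.cong refl) (simp add: coeff)
  also have "\<dots> = diff_op f g n b 0 x 0 (\<lambda>z. F z * H z)"
    by (simp add: diff_op_node_prod mult_ac)
  finally show ?thesis by simp
qed

end
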